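(* The irreducible mutation-preserving generalized cluster algebras $\mathcal{A}(B;R;\mathcal{Z})$ are precisely the irreducible generalized cluster algebras of the following forms: (1) $\mathcal{A}(B;R;\mathcal{Z})$ is of rank $2$, with arbitrary coefficients for $\mathcal{Z}$. (2) $\mathcal{A}(B;R;\mathcal{Z})$ is of rank $3$, with the pair $(B;R)$ in the list (I.1)--(III.4) given in the context, except (II.2), and with arbitrary coefficients for $\mathcal{Z}$. (3) $\mathcal{A}(B;R;\mathcal{Z})$ is of rank $3$, with the pair $(B;R)$ given in (II.2) of that list, and the coefficients for $\mathcal{Z}$ satisfy the reciprocity condition.
   Context: $\mathbb{N}$ denotes the non-negative integers, $[a]_+=\max\{a,0\}$. Let $\mathcal{F}$ be the field of rational functions in $n$ independent variables over $\mathbb{Q}$. Generalized seed of rank $n$: a triple $(\mathbf{x},B,\mathcal{Z})$ where $\mathbf{x}=(x_1,\dots,x_n)$ is an $n$-tuple of algebraically independent generators of $\mathcal{F}$, $B=(b_{ij})$ is an $n\times n$ skew-symmetrizable integer matrix, and $\mathcal{Z}=(Z_1,\dots,Z_n)$ is a tuple of polynomials $Z_i(u)=z_{i,0}+z_{i,1}u+\cdots+z_{i,r_i}u^{r_i}$ with coefficients in $\mathbb{N}$, $r_i\ge 1$, and $z_{i,0}=z_{i,r_i}=1$ (monic condition). Put $R=\mathrm{diag}(r_1,\dots,r_n)$. The reciprocity condition is $z_{i,s}=z_{i,r_i-s}$ for all $i,s$. "Arbitrary coefficients" means arbitrary polynomials $Z_i$ of degree $r_i$ with coefficients in $\mathbb{N}$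 satisfying the monic condition $z_{i,0}=z_{i,r_i}=1$ (no reciprocity imposed). Generalized mutation in direction $k$: $(\mathbf{x},B,\mathcal{Z})\mapsto(\mathbf{x}',B',\mathcal{Z}')$, where $x_i'=x_i$ for $i\ne k$ and $x_k'=x_k^{-1}\big(\prod_j x_j^{[-b_{jk}]_+}\big)^{r_k}Z_k\big(\prod_j x_j^{b_{jk}}\big)$; $b'_{ij}=-b_{ij}$ if $i=k$ or $j=k$, and $b'_{ij}=b_{ij}+r_k([b_{ik}]_+b_{kj}+b_{ik}[-b_{kj}]_+)$ otherwise; $Z_i'=Z_i$ for $i\neq k$ and $Z_k'(u)=u^{r_k}Z_k(u^{-1})$. This is an involution. A generalized cluster pattern is a collection of generalized seeds $(\mathbf{x}_t,B_t,\mathcal{Z}_t)$ labelled by the vertices $t$ of the $n$-regular tree $\mathbb{T}_n$ (edges labelled by $1,\dots,n$, distinct labels at each vertex), such that seeds joined by an edge labelled $k$ are related by the generalized mutation in direction $k$. Fix an initial vertex $t_0$ with seed $(\mathbf{x},B,\mathcal{Z})$. The generalized cluster algebra $\mathcal{A}(B;R;\mathcal{Z})$ is the $\mathbb{Q}$-subalgebra of $\mathcal{F}$ generated by all the variables $x_{i;t}$. It is irreducible if $B$ is irreducible, i.e. there is no permutation matrix $P$ such that $P^TBP$ is block upper triangular with diagonal square blocks of sizes $k$ and $n-k$, $1\le k\le n-1$. It is mutation-preserving if $\hat\mu_{k;t}=\hat\mu_{k;t_0}$ for all $t\in\mathbb{T}_n$ and $k\in\{1,\dots,n\}$, where $\hat\mu_{k;t}$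 is the (rational) map on $n$-tuples of nonzero rational functions in $x_1,\dots,x_n$ over $\mathbb{Q}$ given by $\hat\mu_{k;t}(f_1,\dots,f_n)=(f_1',\dots,f_n')$ with $f_i'=f_i$ for $i\ne k$ and $f_k'=f_k^{-1}\big(\prod_j f_j^{[-b_{jk;t}]_+}\big)^{r_k}Z_{k;t}\big(\prod_j f_j^{b_{jk;t}}\big)$. For $\sigma\in\mathfrak{S}_3$, $\sigma(B)_{ij}=b_{\sigma^{-1}(i)\sigma^{-1}(j)}$ and $\sigma(R)=\mathrm{diag}(r_{\sigma^{-1}(1)},r_{\sigma^{-1}(2)},r_{\sigma^{-1}(3)})$. The list consists of all pairs $(B;R)=(\sigma(B^\circ);\sigma(R^\circ))$, $\sigma\in\mathfrak{S}_3$, with $(B^\circ;R^\circ)$ one of: (I.1) $\begin{pmatrix}0&2&-2\\-2&0&2\\2&-2&0\end{pmatrix}$, $\mathrm{diag}(1,1,1)$; (I.2) $\begin{pmatrix}0&2&-2\\-1&0&2\\1&-2&0\end{pmatrix}$, $\mathrm{diag}(2,1,1)$; (I.3) $\begin{pmatrix}0&1&-2\\-1&0&2\\1&-1&0\end{pmatrix}$, $\mathrm{diag}(2,2,1)$; (I.4) $\begin{pmatrix}0&1&-1\\-1&0&1\\1&-1&0\end{pmatrix}$, $\mathrm{diag}(2,2,2)$; (II.1) $\begin{pmatrix}0&1&-1\\-2&0&2\\2&-2&0\end{pmatrix}$, $\mathrm{diag}(2,1,1)$; (II.2) $\begin{pmatrix}0&1&-1\\-1&0&2\\1&-2&0\end{pmatrix}$,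 $\mathrm{diag}(4,1,1)$; (II.3) $\begin{pmatrix}0&1&-1\\-4&0&2\\4&-2&0\end{pmatrix}$, $\mathrm{diag}(1,1,1)$; (III.1) $\begin{pmatrix}0&4&-4\\-1&0&2\\1&-2&0\end{pmatrix}$, $\mathrm{diag}(1,1,1)$; (III.2) $\begin{pmatrix}0&2&-4\\-1&0&2\\1&-1&0\end{pmatrix}$, $\mathrm{diag}(1,2,1)$; (III.3) $\begin{pmatrix}0&4&-2\\-1&0&1\\1&-2&0\end{pmatrix}$, $\mathrm{diag}(1,1,2)$; (III.4) $\begin{pmatrix}0&2&-2\\-1&0&1\\1&-1&0\end{pmatrix}$, $\mathrm{diag}(1,2,2)$.
   Formalization: Case (1) requires the reciprocity condition instead of arbitrary coefficients, since every irreducible rank 2 algebra without it fails to be mutation-preserving; the rank is assumed at least 2, since rank 1 algebras are irreducible and mutation-preserving but not listed. *)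

theory Defs
  imports
    "HOL-Library.Poly_Mapping"
    "HOL-Computational_Algebra.Fraction_Field"
    "HOL-Computational_Algebra.Polynomial"
    "HOL-Combinatorics.Permutations"
    "Jordan_Normal_Form.Matrix"
begin

text \<open>
  All indices are shifted by one: directions, matrix rows and columns and tuple positions run
  over \<open>0, \<dots>, n - 1\<close>.

  The type below is the field of rational functions over the rationals in countably many
  variables; the ambient field of rank \<open>n\<close> is its subfield \<open>ratfun_field n\<close> of rational functions
  in the first \<open>n\<close> variables.
\<close>

type_synonym mpoly_rat = "(nat \<Rightarrow>\<^sub>0 nat) \<Rightarrow>\<^sub>0 rat"
type_synonym ratfun = "mpoly_rat fract"

definition mpolys :: "nat \<Rightarrow> mpoly_rat set" where
  "mpolys n = {p. \<forall>m \<in> Poly_Mapping.keys p. Poly_Mapping.keys m \<subseteq> {..<n}}"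

definition ratfun_field :: "nat \<Rightarrow> ratfun set" where
  "ratfun_field n = {Fraction_Field.Fract p q |p q. p \<in> mpolys n \<and> q \<in> mpolys n \<and> q \<noteq> 0}"

definition ratfun_const :: "rat \<Rightarrow> ratfun" where
  "ratfun_const c = Fraction_Field.Fract (Poly_Mapping.single 0 c) 1"

definition mpoly_eval :: "mpoly_rat \<Rightarrow> ratfun vec \<Rightarrow> ratfun" where
  "mpoly_eval p x =
     (\<Sum>m \<in> Poly_Mapping.keys p. ratfun_const (Poly_Mapping.lookup p m) * (\<Prod>i \<in> Poly_Mapping.keys m. x $ i ^ Poly_Mapping.lookup m i))"

definition alg_indep :: "nat \<Rightarrow> ratfun vec \<Rightarrow> bool" where
  "alg_indep n x \<longleftrightarrow> (\<forall>p \<in> mpolys n. mpoly_eval p x = 0 \<longrightarrow> p = 0)"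

definition field_generators :: "nat \<Rightarrow> ratfun vec \<Rightarrow> bool" where
  "field_generators n x \<longleftrightarrow>
     ratfun_field n =
       {mpoly_eval p x / mpoly_eval q x |p q. p \<in> mpolys n \<and> q \<in> mpolys n \<and> mpoly_eval q x \<noteq> 0}"


definition skew_symmetrizable :: "nat \<Rightarrow> int mat \<Rightarrow> bool" where
  "skew_symmetrizable n B \<longleftrightarrow>
     (\<exists>d :: nat \<Rightarrow> int. (\<forall>i<n. d i > 0) \<and>
        transpose_mat (mat_diag n d * B) = - (mat_diag n d * B))"

definition perm_matrix :: "nat \<Rightarrow> (nat \<Rightarrow> nat) \<Rightarrow> int mat" where
  "perm_matrix n \<pi> = mat n n (\<lambda>(i, j). if i = \<pi> j then 1 else 0)"

definition irreducible_mat :: "nat \<Rightarrow> int mat \<Rightarrow> bool" where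
  "irreducible_mat n B \<longleftrightarrow>
     \<not> (\<exists>\<pi> k. \<pi> permutes {..<n} \<and> 1 \<le> k \<and> k \<le> n - 1 \<and>
          (\<forall>i \<in> {k..<n}. \<forall>j<k.
             (transpose_mat (perm_matrix n \<pi>) * B * perm_matrix n \<pi>) $$ (i, j) = 0))"


text \<open>
  A seed is a triple \<open>(x, B, Z)\<close>. The coefficients of the polynomials are natural numbers, and
  \<open>r\<^sub>i\<close> is the degree of \<open>Z\<^sub>i\<close>, so the leading coefficient is the coefficient at \<open>r\<^sub>i\<close>.
\<close>

type_synonym gseed = "ratfun vec \<times> int mat \<times> nat poly vec"

definition is_gseed :: "nat \<Rightarrow> gseed \<Rightarrow> bool" where
  "is_gseed n = (\<lambda>(x, B, Z).
     x \<in> carrier_vec n \<and> (\<forall>i<n. x $ i \<in> ratfun_field n) \<and>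
     alg_indep n x \<and> field_generators n x \<and>
     B \<in> carrier_mat n n \<and> skew_symmetrizable n B \<and>
     Z \<in> carrier_vec n \<and>
     (\<forall>i<n. Polynomial.degree (Z $ i) \<ge> 1 \<and> coeff (Z $ i) 0 = 1 \<and> lead_coeff (Z $ i) = 1))"

definition degree_mat :: "nat \<Rightarrow> nat poly vec \<Rightarrow> int mat" where
  "degree_mat n Z = mat_diag n (\<lambda>i. int (Polynomial.degree (Z $ i)))"

definition reciprocal :: "nat \<Rightarrow> nat poly vec \<Rightarrow> bool" where
  "reciprocal n Z \<longleftrightarrow>
     (\<forall>i<n. \<forall>s \<le> Polynomial.degree (Z $ i).
        coeff (Z $ i) s = coeff (Z $ i) (Polynomial.degree (Z $ i) - s))"

text \<open>
  Reciprocity is automatic when all degrees are at most 2. For larger degrees it cannot be dropped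
  in rank 2: mutation in the other direction turns \<open>B\<close> into \<open>-B\<close> without reversing \<open>Z\<^sub>i\<close>, so the map in
  direction \<open>i\<close> is unchanged only if \<open>Z\<^sub>i\<close> is palindromic. For instance, for
  \<open>B = ((0, 1), (-1, 0))\<close>, \<open>Z\<^sub>1 = 1 + u + 2u^2 + u^3\<close> and \<open>Z\<^sub>2 = 1 + u\<close>, the first coordinate of the map
  in direction 1 at \<open>f = (1, 2)\<close> is 17 before and 19 after mutation in direction 2.
\<close>

definition pos_part :: "int \<Rightarrow> int" where
  "pos_part a = max a 0"

text \<open>
  The rational map \<open>(f\<^sub>1, \<dots>, f\<^sub>n) \<mapsto> (f\<^sub>1', \<dots>, f\<^sub>n')\<close> attached to \<open>(B, Z)\<close> in direction \<open>k\<close>. It is used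
  both for the exchange relation and for the maps compared in the definition of
  mutation-preserving; all arguments of interest have nonzero entries, so that the integer
  powers are the usual ones.
\<close>

definition mut_map :: "nat \<Rightarrow> nat \<Rightarrow> int mat \<Rightarrow> nat poly vec \<Rightarrow> ratfun vec \<Rightarrow> ratfun vec" where
  "mut_map n k B Z f = vec n (\<lambda>i.
     if i = k then
       inverse (f $ k)
       * (\<Prod>j<n. f $ j powi pos_part (- (B $$ (j, k)))) ^ Polynomial.degree (Z $ k)
       * poly (map_poly of_nat (Z $ k)) (\<Prod>j<n. f $ j powi (B $$ (j, k)))
     else f $ i)"

definition mut_mat :: "nat \<Rightarrow> nat \<Rightarrow> nat poly vec \<Rightarrow> int mat \<Rightarrow> int mat" where
  "mut_mat n k Z B = mat n n (\<lambda>(i, j).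
     if i = k \<or> j = k then - (B $$ (i, j))
     else B $$ (i, j) + int (Polynomial.degree (Z $ k)) *
            (pos_part (B $$ (i, k)) * B $$ (k, j) + B $$ (i, k) * pos_part (- (B $$ (k, j)))))"

definition mut_polys :: "nat \<Rightarrow> nat \<Rightarrow> nat poly vec \<Rightarrow> nat poly vec" where
  "mut_polys n k Z = vec n (\<lambda>i. if i = k then reflect_poly (Z $ k) else Z $ i)"

definition mutate :: "nat \<Rightarrow> nat \<Rightarrow> gseed \<Rightarrow> gseed" where
  "mutate n k = (\<lambda>(x, B, Z). (mut_map n k B Z x, mut_mat n k Z B, mut_polys n k Z))"


text \<open>
  The \<open>n\<close>-regular tree with edges labelled by directions: its vertices are the words in
  \<open>{0, \<dots>, n - 1}\<close> without two equal adjacent letters, and appending the letter \<open>k\<close> traverses the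
  edge labelled \<open>k\<close>. At a vertex ending in \<open>k\<close>, the edge labelled \<open>k\<close> leads back to the word with
  that last letter removed.
\<close>

definition tree_vertices :: "nat \<Rightarrow> nat list set" where
  "tree_vertices n = {w. set w \<subseteq> {..<n} \<and> distinct_adj w}"

definition tree_edge :: "nat \<Rightarrow> nat \<Rightarrow> nat list \<Rightarrow> nat list \<Rightarrow> bool" where
  "tree_edge n k s t \<longleftrightarrow>
     s \<in> tree_vertices n \<and> t \<in> tree_vertices n \<and> (t = s @ [k] \<or> s = t @ [k])"

definition gen_cluster_pattern :: "nat \<Rightarrow> (nat list \<Rightarrow> gseed) \<Rightarrow> bool" where
  "gen_cluster_pattern n \<Sigma> \<longleftrightarrow>
     (\<forall>t \<in> tree_vertices n. is_gseed n (\<Sigma> t)) \<and>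
     (\<forall>k s t. tree_edge n k s t \<longrightarrow> \<Sigma> t = mutate n k (\<Sigma> s))"

text \<open>
  The subalgebra itself. Irreducibility and mutation-preservation are properties of the seeds
  defining it.
\<close>

inductive_set gen_cluster_algebra :: "nat \<Rightarrow> (nat list \<Rightarrow> gseed) \<Rightarrow> ratfun set"
  for n \<Sigma> where
  const: "ratfun_const c \<in> gen_cluster_algebra n \<Sigma>"
| var: "t \<in> tree_vertices n \<Longrightarrow> i < n \<Longrightarrow> fst (\<Sigma> t) $ i \<in> gen_cluster_algebra n \<Sigma>"
| add: "f \<in> gen_cluster_algebra n \<Sigma> \<Longrightarrow> g \<in> gen_cluster_algebra n \<Sigma>
    \<Longrightarrow> f + g \<in> gen_cluster_algebra n \<Sigma>"
| mult: "f \<in> gen_cluster_algebra n \<Sigma> \<Longrightarrow> g \<in> gen_cluster_algebra n \<Sigma>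
    \<Longrightarrow> f * g \<in> gen_cluster_algebra n \<Sigma>"

definition mut_map_at :: "nat \<Rightarrow> (nat list \<Rightarrow> gseed) \<Rightarrow> nat \<Rightarrow> nat list \<Rightarrow> ratfun vec \<Rightarrow> ratfun vec" where
  "mut_map_at n \<Sigma> k t = (case \<Sigma> t of (x, B, Z) \<Rightarrow> mut_map n k B Z)"

definition mutation_preserving :: "nat \<Rightarrow> (nat list \<Rightarrow> gseed) \<Rightarrow> nat list \<Rightarrow> bool" where
  "mutation_preserving n \<Sigma> t\<^sub>0 \<longleftrightarrow>
     (\<forall>t \<in> tree_vertices n. \<forall>k<n. \<forall>f \<in> carrier_vec n.
        (\<forall>i<n. f $ i \<in> ratfun_field n \<and> f $ i \<noteq> 0) \<longrightarrow>
        mut_map_at n \<Sigma> k t f = mut_map_at n \<Sigma> k t\<^sub>0 f)"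


definition mat3 :: "int list list \<Rightarrow> int mat" where
  "mat3 = mat_of_rows_list 3"

definition diag3 :: "int list \<Rightarrow> int mat" where
  "diag3 r = mat_diag 3 (\<lambda>i. r ! i)"

definition pair_II2 :: "int mat \<times> int mat" where
  "pair_II2 = (mat3 [[0, 1, -1], [-1, 0, 2], [1, -2, 0]], diag3 [4, 1, 1])"

definition listed_pairs :: "(int mat \<times> int mat) set" where
  "listed_pairs = {
     (mat3 [[0, 2, -2], [-2, 0, 2], [2, -2, 0]], diag3 [1, 1, 1]),
     (mat3 [[0, 2, -2], [-1, 0, 2], [1, -2, 0]], diag3 [2, 1, 1]),
     (mat3 [[0, 1, -2], [-1, 0, 2], [1, -1, 0]], diag3 [2, 2, 1]),
     (mat3 [[0, 1, -1], [-1, 0, 1], [1, -1, 0]], diag3 [2, 2, 2]),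
     (mat3 [[0, 1, -1], [-2, 0, 2], [2, -2, 0]], diag3 [2, 1, 1]),
     pair_II2,
     (mat3 [[0, 1, -1], [-4, 0, 2], [4, -2, 0]], diag3 [1, 1, 1]),
     (mat3 [[0, 4, -4], [-1, 0, 2], [1, -2, 0]], diag3 [1, 1, 1]),
     (mat3 [[0, 2, -4], [-1, 0, 2], [1, -1, 0]], diag3 [1, 2, 1]),
     (mat3 [[0, 4, -2], [-1, 0, 1], [1, -2, 0]], diag3 [1, 1, 2]),
     (mat3 [[0, 2, -2], [-1, 0, 1], [1, -1, 0]], diag3 [1, 2, 2])}"

definition perm_act :: "(nat \<Rightarrow> nat) \<Rightarrow> int mat \<Rightarrow> int mat" where
  "perm_act \<sigma> A = mat 3 3 (\<lambda>(i, j). A $$ (inv_into UNIV \<sigma> i, inv_into UNIV \<sigma> j))"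

definition perm_closure :: "(int mat \<times> int mat) set \<Rightarrow> (int mat \<times> int mat) set" where
  "perm_closure P =
     {(perm_act \<sigma> B, perm_act \<sigma> R) |\<sigma> B R. \<sigma> permutes {..<3} \<and> (B, R) \<in> P}"

end

theory Submission
  imports Defs
begin

text \<open>
  The exchange map in direction \<open>i\<close> determines column \<open>i\<close> of \<open>B\<close> and \<open>Z\<^sub>i\<close> up to negating the column
  and reversing \<open>Z\<^sub>i\<close> simultaneously. A mutation at \<open>k\<close> negates the entry \<open>(k, i)\<close> but keeps \<open>Z\<^sub>i\<close>, so
  if this entry is nonzero, invariance of the map forces \<open>Z\<^sub>i\<close> to be palindromic and the whole column
  to change sign. The latter means that any two edges \<open>i - k - j\<close> complete to a cyclically oriented
  triangle with \<open>2 |b\<^sub>j\<^sub>i| = r\<^sub>k |b\<^sub>j\<^sub>k| |b\<^sub>k\<^sub>i|\<close>. An irreducible \<open>B\<close> is then a complete graph, which has at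
  most three vertices because a vertex with three neighbours would lie on a triangle that is not
  cyclic. In rank 3 the six equations give \<open>r\<^sub>i r\<^sub>k |b\<^sub>i\<^sub>k| |b\<^sub>k\<^sub>i| = 4\<close>, which leaves finitely many cases.
  Conversely, under these conditions every mutation maps \<open>(B, Z)\<close> to \<open>(-B, Z)\<close>.
\<close>

section \<open>Monomial expansion of the exchange map\<close>

text \<open>Since \<open>a = [a]_+ - [-a]_+\<close>, the exponent \<open>[-a]_+ * r + a * s\<close>
  of a variable in the \<open>s\<close>-th term of the exchange relation splits into two parts that
  are non-negative for \<open>s <= r\<close>. As a natural number it turns the numerator of the
  relation into a genuine polynomial.\<close>

definition exch_exp :: "int \<Rightarrow> nat \<Rightarrow> nat \<Rightarrow> nat" where
  "exch_exp a r s = nat (pos_part a) * s + nat (pos_part (- a)) * (r - s)"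

text \<open>This symmetry causes the ambiguity of the exchange map: negating a column amounts to
  reversing the order of the terms.\<close>

lemma exch_exp_uminus: "s \<le> r \<Longrightarrow> exch_exp (- a) r s = exch_exp a r (r - s)"
  by (simp add: exch_exp_def)

text \<open>Distinct terms have distinct degrees in a variable that occurs with nonzero
  \<open>a\<close>, so their coefficients can be read off separately.\<close>

lemma exch_exp_inj:
  assumes "a \<noteq> 0" "s \<le> r" "s' \<le> r" "exch_exp a r s = exch_exp a r s'"
  shows "s = s'"
proof (cases "a > 0")
  case True
  then show ?thesis
    using assms(4) by (simp add: exch_exp_def pos_part_def)
next
  case False
  then have "nat (- a) \<noteq> 0" and "exch_exp a r u = nat (- a) * (r - u)" for u
    using assms(1) by (simp_all add: exch_exp_def pos_part_def)
  then have "r - s = r - s'"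
    using assms(4) by simp
  then show ?thesis
    using assms(2,3) by linarith
qed

lemma exch_exp_powi:
  fixes x :: ratfun
  assumes "x \<noteq> 0" "s \<le> r"
  shows "(x powi pos_part (- a)) ^ r * (x powi a) ^ s = x ^ exch_exp a r s"
proof (cases "a \<ge> 0")
  case True
  define m where "m = nat a"
  then have "a = int m" using True by simp
  then show ?thesis
    by (simp add: exch_exp_def pos_part_def max_def power_mult)
next
  case False
  define m where "m = nat (- a)"
  then have a: "a = - int m" using False by simp
  have "x ^ (m * r) * inverse (x ^ m) ^ s = x ^ (m * (r - s))"
  proof -
    have "x ^ (m * r) = x ^ (m * (r - s)) * (x ^ m) ^ s"
    proof -
      have "m * r = m * (r - s) + m * s"
        using assms(2) by (simp flip: add_mult_distrib2)
      then show ?thesis by (simp only: power_add power_mult)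
    qed
    then show ?thesis using assms(1) by (simp add: field_simps)
  qed
  then show ?thesis using False
    by (simp add: a exch_exp_def pos_part_def max_def power_mult power_int_minus)
qed

lemma poly_map_of_nat:
  "poly (map_poly of_nat p) (y :: ratfun) = (\<Sum>s\<le>Polynomial.degree p. of_nat (coeff p s) * y ^ s)"
proof -
  let ?q = "map_poly of_nat p :: ratfun poly"
  have "poly ?q y = (\<Sum>s\<le>Polynomial.degree ?q. coeff ?q s * y ^ s)"
    by (rule poly_altdef)
  also have "\<dots> = (\<Sum>s\<le>Polynomial.degree p. coeff ?q s * y ^ s)"
    using degree_le[of "Polynomial.degree p" ?q]
    by (intro sum.mono_neutral_left) (auto simp: coeff_map_poly coeff_eq_0)
  finally show ?thesis by (simp add: coeff_map_poly)
qed

lemma mut_map_expand: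
  assumes "k < n" "\<And>j. j < n \<Longrightarrow> f $ j \<noteq> 0"
  shows "mut_map n k B Z f $ k = inverse (f $ k) *
    (\<Sum>s\<le>Polynomial.degree (Z $ k). of_nat (coeff (Z $ k) s) *
       (\<Prod>j<n. f $ j ^ exch_exp (B $$ (j, k)) (Polynomial.degree (Z $ k)) s))"
proof -
  let ?r = "Polynomial.degree (Z $ k)"
  have "(\<Prod>j<n. f $ j powi pos_part (- B $$ (j, k))) ^ ?r * (\<Prod>j<n. f $ j powi B $$ (j, k)) ^ s
      = (\<Prod>j<n. f $ j ^ exch_exp (B $$ (j, k)) ?r s)" if "s \<le> ?r" for s
    using that assms(2) unfolding prod_power_distrib prod.distrib[symmetric]
    by (intro prod.cong refl exch_exp_powi) auto
  then show ?thesis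
    using assms(1) by (simp add: mut_map_def poly_map_of_nat sum_distrib_left mult_ac)
qed

lemma mut_map_nth_other: "i < n \<Longrightarrow> i \<noteq> k \<Longrightarrow> mut_map n k B Z f $ i = f $ i"
  by (simp add: mut_map_def)

text \<open>The monomial of index \<open>s\<close> for \<open>- B\<close> is that of index
  \<open>r - s\<close> for \<open>B\<close>, and reciprocity gives both the same coefficient. The
  sum is merely traversed backwards.\<close>

lemma mut_map_uminus:
  assumes k: "k < n"
    and f: "\<And>j. j < n \<Longrightarrow> f $ j \<noteq> 0"
    and B: "B \<in> carrier_mat n n"
    and rec: "reciprocal n Z"
  shows "mut_map n k (- B) Z f = mut_map n k B Z f"
proof (rule eq_vecI)
  fix i assume "i < dim_vec (mut_map n k B Z f)"
  then have i: "i < n" by (simp add: mut_map_def)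
  let ?r = "Polynomial.degree (Z $ k)"
  let ?t = "\<lambda>s. of_nat (coeff (Z $ k) s) * (\<Prod>j<n. f $ j ^ exch_exp (B $$ (j, k)) ?r s)"
  have t: "of_nat (coeff (Z $ k) s) * (\<Prod>j<n. f $ j ^ exch_exp ((- B) $$ (j, k)) ?r s) = ?t (?r - s)"
    if "s \<le> ?r" for s
  proof -
    have "coeff (Z $ k) s = coeff (Z $ k) (?r - s)"
      using rec that k unfolding reciprocal_def by blast
    then show ?thesis
      using that k B by (simp add: exch_exp_uminus)
  qed
  have "(\<Sum>s\<le>?r. of_nat (coeff (Z $ k) s) * (\<Prod>j<n. f $ j ^ exch_exp ((- B) $$ (j, k)) ?r s))
      = (\<Sum>s\<le>?r. ?t (?r - s))"
    using t by (intro sum.cong) auto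
  also have "\<dots> = (\<Sum>s\<le>?r. ?t s)"
    by (rule sum.reindex_bij_witness[of _ "\<lambda>s. ?r - s" "\<lambda>s. ?r - s"]) auto
  finally show "mut_map n k (- B) Z f $ i = mut_map n k B Z f $ i"
    using mut_map_expand[where f = f and Z = Z, OF k f] i by (cases "i = k") (simp_all add: mut_map_nth_other)
qed (simp add: mut_map_def)

section \<open>Recovering a column of \<open>B\<close> and the polynomial \<open>Z_i\<close> from
  the exchange map\<close>

text \<open>Characteristic zero supplies infinitely many integer evaluation points and lets equal
  coefficients be compared as natural numbers.\<close>

lemma of_nat_ratfun_eq_iff: "(of_nat a :: ratfun) = of_nat b \<longleftrightarrow> a = b"
proof
  assume "(of_nat a :: ratfun) = of_nat b"
  then have "(of_nat a :: mpoly_rat) = of_nat b"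
    using Fraction_Field.eq_fract(1)[of "1 :: mpoly_rat" 1 "of_nat a" "of_nat b"] by (simp add: Fraction_Field.Fract_of_nat_eq)
  then show "a = b" by simp
qed simp

lemma of_nat_in_ratfun_field: "of_nat a \<in> ratfun_field n"
proof -
  have "Poly_Mapping.keys (of_nat a :: mpoly_rat) \<subseteq> {0}"
    by (simp only: single_of_nat[symmetric] keys_single) simp
  then have "(of_nat a :: mpoly_rat) \<in> mpolys n"
    by (auto simp: mpolys_def)
  moreover have "(1 :: mpoly_rat) \<in> mpolys n"
    by (simp add: mpolys_def)
  ultimately have "Fraction_Field.Fract (of_nat a) 1 \<in> ratfun_field n"
    unfolding ratfun_field_def mem_Collect_eq by (intro exI[of _ "of_nat a"] exI[of _ "1 :: mpoly_rat"] conjI refl) simp_all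
  then show ?thesis by (simp only: Fraction_Field.Fract_of_nat_eq)
qed

text \<open>
  Substituting integers for all variables but one turns the exchange polynomial into a polynomial
  in one variable, whose coefficients can be compared.
\<close>

lemma mut_map_eq_imp_negated:
  assumes i: "i < n" and k: "k < n" "k \<noteq> i" and j: "j < n" "j \<noteq> k"
    and bk: "B $$ (k, i) \<noteq> 0" "B' $$ (k, i) = - B $$ (k, i)"
    and lc: "coeff (Z $ i) 0 = 1" "lead_coeff (Z $ i) = 1" "Polynomial.degree (Z $ i) \<ge> 1"
    and eq: "\<And>f. f \<in> carrier_vec n \<Longrightarrow> (\<And>l. l < n \<Longrightarrow> f $ l \<in> ratfun_field n \<and> f $ l \<noteq> 0) \<Longrightarrow>
               mut_map n i B' Z f $ i = mut_map n i B Z f $ i"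
  shows "B' $$ (j, i) = - B $$ (j, i)"
    and "\<And>s. s \<le> Polynomial.degree (Z $ i) \<Longrightarrow>
           coeff (Z $ i) s = coeff (Z $ i) (Polynomial.degree (Z $ i) - s)"
proof -
  define r where "r = Polynomial.degree (Z $ i)"
  define b where "b = B $$ (k, i)"
  define g where "g = B $$ (j, i)"
  define g' where "g' = B' $$ (j, i)"
  define z where "z = coeff (Z $ i)"
  \<comment> \<open>\<open>F\<close> and \<open>G\<close> are the numerators for \<open>B\<close>
    and \<open>B'\<close> after variable \<open>k\<close> becomes the indeterminate, variable
    \<open>j\<close> becomes 2 and all others become 1. The exponent of variable \<open>j\<close>
    survives as a power of 2.\<close>
  define F :: "ratfun poly" where
    "F = (\<Sum>s\<le>r. Polynomial.monom (of_nat (z s * 2 ^ exch_exp g r s)) (exch_exp b r s))"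
  define G :: "ratfun poly" where
    "G = (\<Sum>s\<le>r. Polynomial.monom (of_nat (z s * 2 ^ exch_exp g' r s)) (exch_exp (- b) r s))"
  have *: "mut_map n i C Z (vec n (\<lambda>l. if l = k then of_nat (Suc m) else if l = j then of_nat 2 else of_nat 1)) $ i
      = inverse (if i = j then of_nat 2 else of_nat 1) *
        (\<Sum>s\<le>r. of_nat (z s) * (of_nat (Suc m) ^ exch_exp (C $$ (k, i)) r s * of_nat 2 ^ exch_exp (C $$ (j, i)) r s))"
    (is "mut_map n i C Z ?f $ i = _")
    for C m
  proof -
    have nz: "?f $ l \<noteq> 0" if "l < n" for l
      using that of_nat_ratfun_eq_iff[of "Suc m" 0] of_nat_ratfun_eq_iff[of 2 0] by simp
    have "(\<Prod>l<n. ?f $ l ^ e l) = of_nat (Suc m) ^ e k * of_nat 2 ^ e j" for e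
    proof -
      have "(\<Prod>l<n. ?f $ l ^ e l) = (\<Prod>l\<in>{k, j}. ?f $ l ^ e l)"
        using k j by (intro prod.mono_neutral_right) auto
      then show ?thesis using k j by simp
    qed
    then show ?thesis
      using mut_map_expand[of i n ?f C Z, OF i nz] i k by (simp add: r_def z_def)
  qed
  have FG: "poly F (of_nat (Suc m)) = poly G (of_nat (Suc m))" for m
  proof -
    let ?f = "vec n (\<lambda>l. if l = k then of_nat (Suc m) else if l = j then of_nat 2 else of_nat 1) :: ratfun vec"
    have "mut_map n i B' Z ?f $ i = mut_map n i B Z ?f $ i"
    proof (rule eq)
      fix l assume "l < n"
      then show "?f $ l \<in> ratfun_field n \<and> ?f $ l \<noteq> 0"
        using of_nat_in_ratfun_field[of _ n] of_nat_ratfun_eq_iff[of "Suc m" 0]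
          of_nat_ratfun_eq_iff[of 2 0] of_nat_ratfun_eq_iff[of 1 0]
        by (simp del: of_nat_Suc of_nat_numeral of_nat_1 One_nat_def)
    qed simp
    \<comment> \<open>The prefactor is 1/2 if \<open>j = i\<close> and 1 otherwise. It is the same
      nonzero number on both sides and cancels.\<close>
    moreover have nz: "inverse (if i = j then of_nat 2 else of_nat 1) \<noteq> (0 :: ratfun)"
      using of_nat_ratfun_eq_iff[of 2 0] by simp
    ultimately have "(\<Sum>s\<le>r. of_nat (z s) * (of_nat (Suc m) ^ exch_exp (- b) r s * of_nat 2 ^ exch_exp g' r s))
        = (\<Sum>s\<le>r. of_nat (z s) * (of_nat (Suc m) ^ exch_exp b r s * of_nat 2 ^ exch_exp g r s) :: ratfun)"
      unfolding * bk(2) b_def[symmetric] g_def[symmetric] g'_def[symmetric]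
      unfolding mult_left_cancel[OF nz] by blast
    then show ?thesis
      by (simp add: F_def G_def poly_sum poly_monom mult_ac)
  qed
  \<comment> \<open>Both polynomials agree at every positive integer, hence at infinitely many
    points.\<close>
  have "F = G"
  proof (rule ccontr)
    assume "F \<noteq> G"
    then have "finite {x. poly (F - G) x = 0}"
      by (intro poly_roots_finite) simp
    moreover have "range (\<lambda>m. of_nat (Suc m)) \<subseteq> {x. poly (F - G) x = 0}"
      using FG by auto
    moreover have "inj (\<lambda>m. of_nat (Suc m) :: ratfun)"
      by (rule injI) (use of_nat_ratfun_eq_iff in blast)
    ultimately show False
      by (meson finite_subset finite_imageD infinite_UNIV_nat)
  qed
  \<comment> \<open>As \<open>b\<close> is nonzero, a single term reaches this degree: the one of
    index \<open>s\<close> in \<open>F\<close>, and the one of index \<open>r - s\<close> in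
    \<open>G\<close>, where \<open>b\<close> has the opposite sign.\<close>
  have cF: "coeff F (exch_exp b r s) = of_nat (z s * 2 ^ exch_exp g r s)" if "s \<le> r" for s
  proof -
    have "coeff F (exch_exp b r s) =
        (\<Sum>u\<le>r. if u = s then of_nat (z u * 2 ^ exch_exp g r u) else 0)"
      unfolding F_def coeff_sum using that bk(1)
      by (intro sum.cong) (use exch_exp_inj[of b _ r s] in \<open>auto simp: b_def\<close>)
    then show ?thesis using that by simp
  qed
  have cG: "coeff G (exch_exp b r s) = of_nat (z (r - s) * 2 ^ exch_exp g' r (r - s))" if "s \<le> r" for s
  proof -
    have "coeff G (exch_exp b r s) =
        (\<Sum>u\<le>r. if u = r - s then of_nat (z u * 2 ^ exch_exp g' r u) else 0)"
      unfolding G_def coeff_sum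
    proof (intro sum.cong refl)
      fix u assume "u \<in> {..r}"
      then have "exch_exp (- b) r u = exch_exp b r (r - u)" "u \<le> r"
        by (simp_all add: exch_exp_uminus)
      moreover have "exch_exp b r (r - u) = exch_exp b r s \<longleftrightarrow> u = r - s"
        using that bk(1) exch_exp_inj[of b "r - u" r s] \<open>u \<le> r\<close> by (auto simp: b_def)
      ultimately show "coeff (Polynomial.monom (of_nat (z u * 2 ^ exch_exp g' r u)) (exch_exp (- b) r u))
            (exch_exp b r s) = (if u = r - s then of_nat (z u * 2 ^ exch_exp g' r u) else 0 :: ratfun)"
        by (simp add: eq_commute)
    qed
    then show ?thesis using that by simp
  qed
  have main: "z s * 2 ^ exch_exp g r s = z (r - s) * 2 ^ exch_exp g' r (r - s)" if "s \<le> r" for s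
    using cF[OF that] cG[OF that] \<open>F = G\<close> of_nat_ratfun_eq_iff by metis
  have "z 0 = 1" "z r = 1" "r \<ge> 1"
    using lc by (simp_all add: z_def r_def)
  \<comment> \<open>At both ends the coefficients are 1, so the powers of 2 alone must match. This
    determines the positive and the negative part of \<open>g'\<close>.\<close>
  then have "exch_exp g r 0 = exch_exp g' r r" "exch_exp g r r = exch_exp g' r 0"
    using main[of 0] main[of r] by simp_all
  then have g': "g' = - g"
  proof -
    have "pos_part (- g) = pos_part g'" "pos_part g = pos_part (- g')"
      using \<open>exch_exp g r 0 = _\<close> \<open>exch_exp g r r = _\<close> \<open>r \<ge> 1\<close>
      by (simp_all add: exch_exp_def) (simp_all add: pos_part_def eq_nat_nat_iff)
    then show ?thesis by (simp add: pos_part_def max_def split: if_splits)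
  qed
  then show "B' $$ (j, i) = - B $$ (j, i)"
    by (simp add: g_def g'_def)
  \<comment> \<open>With \<open>g' = - g\<close> the powers of 2 in \<open>main\<close> coincide and
    cancel.\<close>
  show "coeff (Z $ i) s = coeff (Z $ i) (Polynomial.degree (Z $ i) - s)"
    if "s \<le> Polynomial.degree (Z $ i)" for s
    using main[of s] that exch_exp_uminus[of "r - s" r g]
    by (simp add: g' r_def z_def)
qed

section \<open>Signs, permutations and irreducibility of matrices\<close>

lemma skew_symmetrizable_entries:
  assumes "skew_symmetrizable n B" "B \<in> carrier_mat n n" "i < n" "j < n"
  shows "B $$ (i, j) > 0 \<longleftrightarrow> B $$ (j, i) < 0" "B $$ (i, i) = 0"
proof -
  obtain d :: "nat \<Rightarrow> int" where d: "\<And>i. i < n \<Longrightarrow> d i > 0"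
    and eq: "transpose_mat (mat_diag n d * B) = - (mat_diag n d * B)"
    using assms(1) by (auto simp: skew_symmetrizable_def)
  have D: "mat_diag n d * B = mat n n (\<lambda>(i, j). d i * B $$ (i, j))"
    using assms(2) by (rule mat_diag_mult_left)
  have e: "d l * B $$ (l, m) = - (d m * B $$ (m, l))" if "l < n" "m < n" for l m
    using arg_cong[OF eq, of "\<lambda>M. M $$ (m, l)"] that by (simp add: D)
  have "B $$ (i, j) > 0 \<longleftrightarrow> d i * B $$ (i, j) > 0"
    using d[OF assms(3)] by (simp add: zero_less_mult_iff)
  also have "\<dots> \<longleftrightarrow> d j * B $$ (j, i) < 0"
    using e[OF assms(3,4)] by simp
  also have "\<dots> \<longleftrightarrow> B $$ (j, i) < 0"
    using d[OF assms(4)] by (simp add: mult_less_0_iff)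
  finally show "B $$ (i, j) > 0 \<longleftrightarrow> B $$ (j, i) < 0" .
  show "B $$ (i, i) = 0"
    using e[OF assms(3,3)] d[OF assms(3)] by simp
qed

lemma perm_matrix_conj:
  assumes "\<pi> permutes {..<n}" "B \<in> carrier_mat n n" "i < n" "j < n"
  shows "(transpose_mat (perm_matrix n \<pi>) * B * perm_matrix n \<pi>) $$ (i, j) = B $$ (\<pi> i, \<pi> j)"
proof -
  have pi: "\<pi> l < n" if "l < n" for l
    using permutes_in_image[OF assms(1), of l] that by simp
  have row: "(transpose_mat (perm_matrix n \<pi>) * B) $$ (i, l) = B $$ (\<pi> i, l)" if "l < n" for l
  proof -
    have "(transpose_mat (perm_matrix n \<pi>) * B) $$ (i, l) =
        (\<Sum>m\<in>{0..<n}. (if m = \<pi> i then 1 else 0) * B $$ (m, l))"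
      using assms that by (simp add: perm_matrix_def scalar_prod_def)
    also have "\<dots> = (\<Sum>m\<in>{0..<n}. if m = \<pi> i then B $$ (m, l) else 0)"
      by (intro sum.cong) auto
    finally show ?thesis using pi assms by simp
  qed
  have "(transpose_mat (perm_matrix n \<pi>) * B * perm_matrix n \<pi>) $$ (i, j) =
      (\<Sum>m\<in>{0..<n}. (transpose_mat (perm_matrix n \<pi>) * B) $$ (i, m) * (if m = \<pi> j then 1 else 0))"
    using assms by (simp add: perm_matrix_def scalar_prod_def)
  also have "\<dots> = (\<Sum>m\<in>{0..<n}. if m = \<pi> j then B $$ (\<pi> i, m) else 0)"
    using row by (intro sum.cong) auto
  finally show ?thesis using pi assms by simp
qed

text \<open>Irreducibility as a form of connectedness: if no entry crossed, listing \<open>S\<close>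
  before its complement would make the matrix block upper triangular.\<close>

lemma irreducible_crossing:
  assumes "irreducible_mat n B" "B \<in> carrier_mat n n" "S \<subseteq> {..<n}" "S \<noteq> {}" "S \<noteq> {..<n}"
  shows "\<exists>i\<in>{..<n} - S. \<exists>j\<in>S. B $$ (i, j) \<noteq> 0"
proof (rule ccontr)
  assume none: "\<not> ?thesis"
  define k where "k = card S"
  have fin: "finite S" using assms(3) finite_subset by blast
  have k: "1 \<le> k" "k < n"
    using assms fin psubset_card_mono[of "{..<n}" S] by (auto simp: k_def Suc_le_eq card_gt_0_iff)
  obtain g where g: "bij_betw g {..<k} S"
    using finite_same_card_bij[of "{..<k}" S] fin by (auto simp: k_def)
  have "card {k..<n} = card ({..<n} - S)"
    using assms(3) fin by (simp add: k_def card_Diff_subset)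
  then obtain h where h: "bij_betw h {k..<n} ({..<n} - S)"
    using finite_same_card_bij[of "{k..<n}" "{..<n} - S"] by auto
  \<comment> \<open>The permutation places \<open>S\<close> in the first \<open>k\<close> positions
    and the complement after it.\<close>
  define \<pi> where "\<pi> = (\<lambda>l. if l < k then g l else if l < n then h l else l)"
  have b1: "bij_betw \<pi> {..<k} S"
    using g by (subst bij_betw_cong[where g = g]) (auto simp: \<pi>_def)
  have b2: "bij_betw \<pi> {k..<n} ({..<n} - S)"
    using h by (subst bij_betw_cong[where g = h]) (auto simp: \<pi>_def)
  have "bij_betw \<pi> ({..<k} \<union> {k..<n}) (S \<union> ({..<n} - S))"
    using b1 b2 by (rule bij_betw_combine) auto
  moreover have "{..<k} \<union> {k..<n} = {..<n}" "S \<union> ({..<n} - S) = {..<n}"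
    using k assms(3) by auto
  ultimately have perm: "\<pi> permutes {..<n}"
    using k by (intro bij_imp_permutes) (auto simp: \<pi>_def)
  have "(transpose_mat (perm_matrix n \<pi>) * B * perm_matrix n \<pi>) $$ (i, j) = 0"
    if "i \<in> {k..<n}" "j < k" for i j
  proof -
    have "\<pi> i \<in> {..<n} - S" "\<pi> j \<in> S"
      using that b1 b2 by (auto dest: bij_betwE)
    then show ?thesis
      using none that k perm_matrix_conj[OF perm assms(2), of i j] by simp
  qed
  then have "\<not> irreducible_mat n B"
    unfolding irreducible_mat_def not_not using perm k
    by (intro exI[of _ \<pi>] exI[of _ k]) simp
  then show False using assms(1) by simp
qed

section \<open>Induction along the tree and comparison of neighbouring seeds\<close>

lemma tree_neighbour_exists:
  assumes "t \<in> tree_vertices n" "k < n"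
  shows "\<exists>t'. tree_edge n k t t'"
proof (cases "t \<noteq> [] \<and> last t = k")
  case True
  then have t: "t = butlast t @ [k]"
    by (metis append_butlast_last_id)
  moreover have "butlast t \<in> tree_vertices n"
    using assms(1) by (subst (asm) t) (auto simp: tree_vertices_def distinct_adj_append_iff)
  ultimately show ?thesis
    using assms(1) unfolding tree_edge_def by metis
next
  case False
  then have "t @ [k] \<in> tree_vertices n"
    using assms by (auto simp: tree_vertices_def distinct_adj_append_iff)
  then show ?thesis
    using assms(1) unfolding tree_edge_def by metis
qed

text \<open>Edges can be walked both ways: the property travels from the base vertex to the empty
  word by deleting last letters, and from there to \<open>t\<close> by appending letters.\<close>

lemma tree_induct:
  assumes "t\<^sub>0 \<in> tree_vertices n" "P t\<^sub>0"
    and step: "\<And>k s t. tree_edge n k s t \<Longrightarrow> k < n \<Longrightarrow> P s \<Longrightarrow> P t"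
    and t: "t \<in> tree_vertices n"
  shows "P t"
proof -
  have pre: "w \<in> tree_vertices n \<and> k < n" if "w @ [k] \<in> tree_vertices n" for w k
    using that by (auto simp: tree_vertices_def distinct_adj_append_iff)
  have "P w \<longrightarrow> P []" if "w \<in> tree_vertices n" for w
    using that
  proof (induction w rule: rev_induct)
    case (snoc k w)
    then show ?case
      using pre[OF snoc.prems] step[of k "w @ [k]" w] by (simp add: tree_edge_def)
  qed simp
  with assms(1,2) have nil: "P []" by blast
  show "P t"
    using t
  proof (induction t rule: rev_induct)
    case (snoc k w)
    then show ?case
      using pre[OF snoc.prems] step[of k w "w @ [k]"] by (simp add: tree_edge_def)
  qed (rule nil)
qed

text \<open>Comparing the base vertex with its neighbour along \<open>k\<close> suffices: there
  \<open>Z_i\<close> is the same because \<open>i\<close> differs from \<open>k\<close>, while the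
  entry \<open>(k, i)\<close> has changed sign, so the recovery lemma applies.\<close>

lemma mutation_preserving_imp:
  assumes pat: "gen_cluster_pattern n \<Sigma>"
    and t0: "t\<^sub>0 \<in> tree_vertices n" "\<Sigma> t\<^sub>0 = (x, B, Z)"
    and mp: "mutation_preserving n \<Sigma> t\<^sub>0"
    and i: "i < n" and k: "k < n" "k \<noteq> i" and bk: "B $$ (k, i) \<noteq> 0"
  shows "\<And>j. j < n \<Longrightarrow> j \<noteq> k \<Longrightarrow> mut_mat n k Z B $$ (j, i) = - B $$ (j, i)"
    and "\<And>s. s \<le> Polynomial.degree (Z $ i) \<Longrightarrow>
           coeff (Z $ i) s = coeff (Z $ i) (Polynomial.degree (Z $ i) - s)"
proof -
  have seed: "is_gseed n (x, B, Z)"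
    using pat t0 unfolding gen_cluster_pattern_def by metis
  then have lc: "coeff (Z $ i) 0 = 1" "lead_coeff (Z $ i) = 1" "Polynomial.degree (Z $ i) \<ge> 1"
    using i by (auto simp: is_gseed_def)
  obtain t where t: "tree_edge n k t\<^sub>0 t"
    using tree_neighbour_exists[OF t0(1) k(1)] by blast
  then have St: "\<Sigma> t = (mut_map n k B Z x, mut_mat n k Z B, mut_polys n k Z)"
    using pat t0(2) by (simp add: gen_cluster_pattern_def mutate_def)
  have Zi: "mut_polys n k Z $ i = Z $ i"
    using i k by (simp add: mut_polys_def)
  have eq: "mut_map n i (mut_mat n k Z B) Z f $ i = mut_map n i B Z f $ i"
    if "f \<in> carrier_vec n" "\<And>l. l < n \<Longrightarrow> f $ l \<in> ratfun_field n \<and> f $ l \<noteq> 0" for f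
  proof -
    have "mut_map_at n \<Sigma> i t f = mut_map_at n \<Sigma> i t\<^sub>0 f"
      using mp that t i unfolding mutation_preserving_def tree_edge_def by blast
    then have "mut_map n i (mut_mat n k Z B) (mut_polys n k Z) f = mut_map n i B Z f"
      by (simp add: mut_map_at_def St t0(2))
    then have "mut_map n i (mut_mat n k Z B) (mut_polys n k Z) f $ i = mut_map n i B Z f $ i"
      by simp
    then show ?thesis
      using i by (simp only: mut_map_def Zi index_vec if_True simp_thms)
  qed
  have bk': "mut_mat n k Z B $$ (k, i) = - B $$ (k, i)"
    using i k by (simp add: mut_mat_def)
  note neg = mut_map_eq_imp_negated[where B = B and B' = "mut_mat n k Z B", OF i k _ _ bk bk' lc eq]
  show "mut_mat n k Z B $$ (j, i) = - B $$ (j, i)" if "j < n" "j \<noteq> k" for j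
    using neg(1) that by blast
  show "coeff (Z $ i) s = coeff (Z $ i) (Polynomial.degree (Z $ i) - s)"
    if "s \<le> Polynomial.degree (Z $ i)" for s
    \<comment> \<open>Any index other than \<open>k\<close> may serve as \<open>j\<close>. The index
      \<open>i\<close> itself is always available, even in rank 2.\<close>
    using neg(2)[OF i _ _ _ that] k by metis
qed

section \<open>Matrices negated by mutation: completeness and cyclic triangles\<close>

text \<open>The equation says that mutation at \<open>k\<close> negates the entry
  \<open>(j, i)\<close>, with the old entry moved to the left-hand side. It is imposed only for
  nonzero \<open>b k i\<close>, since otherwise mutation at \<open>k\<close> leaves column
  \<open>i\<close> unchanged.\<close>

definition mut_negates :: "nat \<Rightarrow> (nat \<Rightarrow> int) \<Rightarrow> (nat \<Rightarrow> nat \<Rightarrow> int) \<Rightarrow> bool" where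
  "mut_negates n r b \<longleftrightarrow>
     (\<forall>i<n. \<forall>j<n. \<forall>k<n. i \<noteq> j \<longrightarrow> j \<noteq> k \<longrightarrow> i \<noteq> k \<longrightarrow> b k i \<noteq> 0 \<longrightarrow>
        - 2 * b j i = r k * (pos_part (b j k) * b k i + b j k * pos_part (- b k i)))"

text \<open>If \<open>b i j\<close> vanished, so would \<open>b j i\<close>, and the equation for
  mutation at \<open>i\<close> would force \<open>b j k = 0\<close>. Once \<open>b j i\<close> is
  nonzero, the equation for mutation at \<open>k\<close> has a nonzero correction term, which
  requires the edges at \<open>k\<close> to form an oriented path.\<close>

lemma mut_negates_path:
  assumes neg: "mut_negates n r b"
    and sgn: "\<And>i j. i < n \<Longrightarrow> j < n \<Longrightarrow> b i j > 0 \<longleftrightarrow> b j i < 0"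
    and ijk: "i < n" "j < n" "k < n" "i \<noteq> j" "j \<noteq> k" "i \<noteq> k"
    and nz: "b i k \<noteq> 0" "b k j \<noteq> 0"
  shows "b i j \<noteq> 0" "b j k > 0 \<longleftrightarrow> b k i > 0"
proof -
  have nz': "b k i \<noteq> 0" "b j k \<noteq> 0"
    using nz sgn ijk by (metis linorder_neq_iff)+
  show ij: "b i j \<noteq> 0"
  proof
    assume "b i j = 0"
    then have "b j i = 0"
      using sgn ijk by (metis linorder_neq_iff)
    moreover have "- 2 * b j k = r i * (pos_part (b j i) * b i k + b j i * pos_part (- b i k))"
      using neg ijk nz unfolding mut_negates_def by blast
    ultimately show False
      using nz' by (simp add: pos_part_def)
  qed
  then have "b j i \<noteq> 0"
    using sgn ijk by (metis linorder_neq_iff)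
  moreover have "- 2 * b j i = r k * (pos_part (b j k) * b k i + b j k * pos_part (- b k i))"
    using neg ijk nz' unfolding mut_negates_def by blast
  ultimately have "pos_part (b j k) * b k i + b j k * pos_part (- b k i) \<noteq> 0"
    by force
  then show "b j k > 0 \<longleftrightarrow> b k i > 0"
    using nz' by (cases "b j k > 0"; cases "b k i > 0") (simp_all add: pos_part_def max_def)
qed

text \<open>The closed neighbourhood of \<open>j\<close> is everything: an edge from an outside
  vertex \<open>u\<close> to a member \<open>v\<close> would give a path from \<open>u\<close> via
  \<open>v\<close> to \<open>j\<close>, making \<open>u\<close> a neighbour of
  \<open>j\<close>.\<close>

lemma irreducible_mut_negates_complete:
  assumes irr: "irreducible_mat n B" and B: "B \<in> carrier_mat n n"
    and sgn: "\<And>i j. i < n \<Longrightarrow> j < n \<Longrightarrow> B $$ (i, j) > 0 \<longleftrightarrow> B $$ (j, i) < 0"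
    and neg: "mut_negates n r (\<lambda>i j. B $$ (i, j))"
    and ij: "i < n" "j < n" "i \<noteq> j"
  shows "B $$ (i, j) \<noteq> 0"
proof -
  define S where "S = insert j {l. l < n \<and> B $$ (l, j) \<noteq> 0}"
  have "S = {..<n}"
  proof (rule ccontr)
    assume "S \<noteq> {..<n}"
    then obtain u v where uv: "u < n" "u \<notin> S" "v \<in> S" "B $$ (u, v) \<noteq> 0"
      using irreducible_crossing[OF irr B, of S] ij by (auto simp: S_def)
    then have "v \<noteq> j" "v < n" "B $$ (v, j) \<noteq> 0" "u \<noteq> j" "u \<noteq> v" "B $$ (u, j) = 0"
      using ij by (auto simp: S_def)
    then show False
      using mut_negates_path(1)[OF neg sgn, of u j v] uv ij by simp
  qed
  then show ?thesis using ij by (auto simp: S_def)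
qed

text \<open>
  All triangles are cyclically oriented, but among three neighbours of a vertex two lie on the same
  side of it.
\<close>

lemma mut_negates_complete_rank:
  assumes sgn: "\<And>i j. i < n \<Longrightarrow> j < n \<Longrightarrow> b i j > 0 \<longleftrightarrow> b j i < 0"
    and neg: "mut_negates n r b"
    and nz: "\<And>i j. i < n \<Longrightarrow> j < n \<Longrightarrow> i \<noteq> j \<Longrightarrow> b i j \<noteq> 0"
  shows "n \<le> 3"
proof (rule ccontr)
  assume "\<not> n \<le> 3"
  have "b j 0 > 0 \<longleftrightarrow> \<not> b i 0 > 0" if ij: "i \<in> {1, 2, 3}" "j \<in> {1, 2, 3}" "i \<noteq> j" for i j
  proof -
    have bd: "i < n" "j < n" "0 < n" "j \<noteq> 0" "i \<noteq> 0"
      using ij \<open>\<not> n \<le> 3\<close> by auto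
    have "b j 0 > 0 \<longleftrightarrow> b 0 i > 0"
      using mut_negates_path(2)[OF neg sgn bd(1-3) ij(3) bd(4,5)] nz bd by simp
    also have "\<dots> \<longleftrightarrow> b i 0 < 0"
      using sgn bd by simp
    also have "\<dots> \<longleftrightarrow> \<not> b i 0 > 0"
      using nz[OF bd(1,3,5)] by linarith
    finally show ?thesis .
  qed
  from this[of 1 2] this[of 2 3] this[of 1 3] show False by simp
qed

section \<open>Seeds differing by the sign of \<open>B\<close>, and the criterion for
  mutation-preservation\<close>

lemma mut_polys_reciprocal:
  assumes "reciprocal n Z" "Z \<in> carrier_vec n"
  shows "mut_polys n k Z = Z"
proof (rule eq_vecI)
  fix i assume "i < dim_vec Z"
  then have i: "i < n" using assms(2) by simp
  have "reflect_poly (Z $ i) = Z $ i"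
  proof (rule poly_eqI)
    fix s
    show "coeff (reflect_poly (Z $ i)) s = coeff (Z $ i) s"
    proof (cases "s \<le> Polynomial.degree (Z $ i)")
      case True
      then have "coeff (Z $ i) s = coeff (Z $ i) (Polynomial.degree (Z $ i) - s)"
        using assms(1) i unfolding reciprocal_def by blast
      then show ?thesis using True by (simp add: coeff_reflect_poly)
    qed (simp add: coeff_reflect_poly coeff_eq_0)
  qed
  then show "mut_polys n k Z $ i = Z $ i"
    using i by (auto simp: mut_polys_def)
qed (use assms(2) in \<open>simp add: mut_polys_def\<close>)

lemma mut_mat_uminus:
  assumes "B \<in> carrier_mat n n" "k < n"
  shows "mut_mat n k Z (- B) = - mut_mat n k Z B"
proof (rule eq_matI)
  fix i j assume "i < dim_row (- mut_mat n k Z B)" "j < dim_col (- mut_mat n k Z B)"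
  then have ij: "i < n" "j < n" by (simp_all add: mut_mat_def)
  \<comment> \<open>This is the equality of the two usual forms of the mutation rule:
    \<open>a [b]_+ - a [-b]_+\<close> and \<open>[a]_+ b - [-a]_+ b\<close> both equal
    \<open>a b\<close>.\<close>
  have "c * (pos_part (- a) * - b + - a * pos_part b) = - (c * (pos_part a * b + a * pos_part (- b)))"
    for a b c :: int
    by (cases "a > 0"; cases "b > 0") (simp_all add: pos_part_def max_def)
  from this[of "int (Polynomial.degree (Z $ k))" "B $$ (i, k)" "B $$ (k, j)"]
  show "mut_mat n k Z (- B) $$ (i, j) = (- mut_mat n k Z B) $$ (i, j)"
    using ij assms by (simp add: mut_mat_def)
qed (simp_all add: mut_mat_def)

lemma mut_mat_eq_uminus:
  assumes B: "B \<in> carrier_mat n n" and skew: "skew_symmetrizable n B" and k: "k < n"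
    and neg: "mut_negates n (\<lambda>i. int (Polynomial.degree (Z $ i))) (\<lambda>i j. B $$ (i, j))"
    and nz: "\<And>i j. i < n \<Longrightarrow> j < n \<Longrightarrow> i \<noteq> j \<Longrightarrow> B $$ (i, j) \<noteq> 0"
  shows "mut_mat n k Z B = - B"
proof (rule eq_matI)
  fix i j assume "i < dim_row (- B)" "j < dim_col (- B)"
  then have ij: "i < n" "j < n" using B by simp_all
  have "mut_mat n k Z B $$ (i, j) = - B $$ (i, j)"
  proof (cases "i = k \<or> j = k \<or> i = j")
    case True
    \<comment> \<open>Diagonal entries are not covered by \<open>neg\<close>, which concerns three
      distinct indices. Their correction term vanishes because the entries \<open>(i, k)\<close> and
      \<open>(k, i)\<close> have opposite signs.\<close>
    have "pos_part (B $$ (i, k)) * B $$ (k, i) + B $$ (i, k) * pos_part (- B $$ (k, i)) = 0"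
      if "i \<noteq> k"
    proof -
      have "B $$ (i, k) \<noteq> 0" "B $$ (k, i) \<noteq> 0"
        using nz that ij k by auto
      then show ?thesis
        using skew_symmetrizable_entries(1)[OF skew B ij(1) k]
        by (cases "B $$ (i, k) > 0"; cases "B $$ (k, i) > 0") (simp_all add: pos_part_def max_def)
    qed
    then show ?thesis
      using True ij k skew_symmetrizable_entries(2)[OF skew B ij(1) k] by (auto simp: mut_mat_def)
  next
    case False
    have "B $$ (k, j) \<noteq> 0" using nz False ij k by auto
    then have "- 2 * B $$ (i, j) = int (Polynomial.degree (Z $ k)) *
        (pos_part (B $$ (i, k)) * B $$ (k, j) + B $$ (i, k) * pos_part (- B $$ (k, j)))"
      using neg False ij k unfolding mut_negates_def by blast
    then show ?thesis using False ij by (simp add: mut_mat_def)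
  qed
  then show "mut_mat n k Z B $$ (i, j) = (- B) $$ (i, j)"
    using ij B by simp
qed (use B in \<open>simp_all add: mut_mat_def\<close>)

lemma mutation_preserving_iff:
  assumes n: "n \<ge> 2" and pat: "gen_cluster_pattern n \<Sigma>"
    and t0: "t\<^sub>0 \<in> tree_vertices n" "\<Sigma> t\<^sub>0 = (x, B, Z)"
    and irr: "irreducible_mat n B"
  shows "mutation_preserving n \<Sigma> t\<^sub>0 \<longleftrightarrow>
    mut_negates n (\<lambda>i. int (Polynomial.degree (Z $ i))) (\<lambda>i j. B $$ (i, j)) \<and> reciprocal n Z"
    (is "_ \<longleftrightarrow> ?neg \<and> _")
proof -
  have "is_gseed n (x, B, Z)"
    using pat t0 unfolding gen_cluster_pattern_def by metis
  then have B: "B \<in> carrier_mat n n" and skew: "skew_symmetrizable n B" and Z: "Z \<in> carrier_vec n"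
    by (simp_all add: is_gseed_def)
  have complete: "B $$ (i, j) \<noteq> 0" if ?neg "i < n" "j < n" "i \<noteq> j" for i j
    using irr B skew_symmetrizable_entries(1)[OF skew B] that
    by (rule irreducible_mut_negates_complete)
  show ?thesis
  proof
    assume mp: "mutation_preserving n \<Sigma> t\<^sub>0"
    note loc = mutation_preserving_imp[OF pat t0 mp]
    have neg: ?neg
      unfolding mut_negates_def
    proof (intro allI impI)
      fix i j k assume *: "i < n" "j < n" "k < n" "i \<noteq> j" "j \<noteq> k" "i \<noteq> k" "B $$ (k, i) \<noteq> 0"
      then have "mut_mat n k Z B $$ (j, i) = - B $$ (j, i)"
        by (intro loc(1)) auto
      then show "- 2 * B $$ (j, i) = int (Polynomial.degree (Z $ k)) *
          (pos_part (B $$ (j, k)) * B $$ (k, i) + B $$ (j, k) * pos_part (- B $$ (k, i)))"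
        using * by (simp add: mut_mat_def)
    qed
    have "reciprocal n Z"
      unfolding reciprocal_def
    proof (intro allI impI)
      fix i s assume i: "i < n" and s: "s \<le> Polynomial.degree (Z $ i)"
      \<comment> \<open>By completeness, available once \<open>neg\<close> is known, every other
        index is a neighbour of \<open>i\<close>; one exists since \<open>n\<close> is at least
        2.\<close>
      define k :: nat where "k = (if i = 0 then 1 else 0)"
      have k: "k < n" "k \<noteq> i" using n by (auto simp: k_def)
      show "coeff (Z $ i) s = coeff (Z $ i) (Polynomial.degree (Z $ i) - s)"
        by (rule loc(2)[OF i k complete[OF neg k(1) i k(2)] s])
    qed
    with neg show "?neg \<and> reciprocal n Z" ..
  next
    assume "?neg \<and> reciprocal n Z"
    then have neg: ?neg and rec: "reciprocal n Z" by auto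
    have mm: "mut_mat n k Z B = - B" if "k < n" for k
      using mut_mat_eq_uminus[OF B skew that neg] complete[OF neg] by blast
    have mm': "mut_mat n k Z (- B) = B" if "k < n" for k
      using mut_mat_uminus[OF B that] mm[OF that] by simp
    \<comment> \<open>Besides the cluster variables, which do not enter the exchange maps, only the
      sign of \<open>B\<close> varies along the tree.\<close>
    have inv: "\<exists>x'. \<Sigma> t = (x', B, Z) \<or> \<Sigma> t = (x', - B, Z)" if "t \<in> tree_vertices n" for t
      using t0(1) _ _ that
    proof (rule tree_induct[where n = n])
      show "\<exists>x'. \<Sigma> t\<^sub>0 = (x', B, Z) \<or> \<Sigma> t\<^sub>0 = (x', - B, Z)" using t0(2) by blast
    next
      fix k s t
      assume "tree_edge n k s t" and k: "k < n" and IH: "\<exists>x'. \<Sigma> s = (x', B, Z) \<or> \<Sigma> s = (x', - B, Z)"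
      then have "\<Sigma> t = mutate n k (\<Sigma> s)"
        using pat unfolding gen_cluster_pattern_def by blast
      with IH show "\<exists>x'. \<Sigma> t = (x', B, Z) \<or> \<Sigma> t = (x', - B, Z)"
        using mm[OF k] mm'[OF k] mut_polys_reciprocal[OF rec Z, of k] by (auto simp: mutate_def)
    qed
    show "mutation_preserving n \<Sigma> t\<^sub>0"
      unfolding mutation_preserving_def
    proof (intro ballI allI impI)
      fix t k f
      assume t: "t \<in> tree_vertices n" and k: "k < n"
        and f: "\<forall>i<n. f $ i \<in> ratfun_field n \<and> f $ i \<noteq> 0"
      have "mut_map n k (- B) Z f = mut_map n k B Z f"
        using f by (intro mut_map_uminus[OF k _ B rec]) auto
      then show "mut_map_at n \<Sigma> k t f = mut_map_at n \<Sigma> k t\<^sub>0 f"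
        using inv[OF t] t0(2) by (auto simp: mut_map_at_def)
    qed
  qed
qed

section \<open>The list of pairs as computable data\<close>

definition rows_II2 :: "int list list \<times> int list" where
  "rows_II2 = ([[0, 1, -1], [-1, 0, 2], [1, -2, 0]], [4, 1, 1])"

text \<open>Nested lists mirror the listed matrices so that the finite checks can be done by
  evaluation.\<close>

definition listed_rows :: "(int list list \<times> int list) list" where
  "listed_rows = [
     ([[0, 2, -2], [-2, 0, 2], [2, -2, 0]], [1, 1, 1]),
     ([[0, 2, -2], [-1, 0, 2], [1, -2, 0]], [2, 1, 1]),
     ([[0, 1, -2], [-1, 0, 2], [1, -1, 0]], [2, 2, 1]),
     ([[0, 1, -1], [-1, 0, 1], [1, -1, 0]], [2, 2, 2]),
     ([[0, 1, -1], [-2, 0, 2], [2, -2, 0]], [2, 1, 1]),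
     rows_II2,
     ([[0, 1, -1], [-4, 0, 2], [4, -2, 0]], [1, 1, 1]),
     ([[0, 4, -4], [-1, 0, 2], [1, -2, 0]], [1, 1, 1]),
     ([[0, 2, -4], [-1, 0, 2], [1, -1, 0]], [1, 2, 1]),
     ([[0, 4, -2], [-1, 0, 1], [1, -2, 0]], [1, 1, 2]),
     ([[0, 2, -2], [-1, 0, 1], [1, -1, 0]], [1, 2, 2])]"

definition perms3 :: "nat list list" where
  "perms3 = [[0, 1, 2], [0, 2, 1], [1, 0, 2], [1, 2, 0], [2, 0, 1], [2, 1, 0]]"

definition perm_rows :: "nat list \<Rightarrow> int list list \<times> int list \<Rightarrow> int list list \<times> int list" where
  "perm_rows p = (\<lambda>(L, R). (map (\<lambda>i. map (\<lambda>j. L ! i ! j) p) p, map ((!) R) p))"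

definition pair_of_rows :: "int list list \<times> int list \<Rightarrow> int mat \<times> int mat" where
  "pair_of_rows = (\<lambda>(L, R). (mat3 L, diag3 R))"

lemma listed_pairs_rows: "listed_pairs = pair_of_rows ` set listed_rows"
  by (simp add: listed_pairs_def listed_rows_def pair_of_rows_def pair_II2_def rows_II2_def)

lemma pair_II2_rows: "pair_II2 = pair_of_rows rows_II2"
  by (simp add: pair_of_rows_def pair_II2_def rows_II2_def)

lemma length_listed_rows: "(L, R) \<in> set listed_rows \<Longrightarrow> length L = 3"
  by (auto simp: listed_rows_def rows_II2_def)

lemma mat3_index: "length L = 3 \<Longrightarrow> i < 3 \<Longrightarrow> j < 3 \<Longrightarrow> mat3 L $$ (i, j) = L ! i ! j"
  by (simp add: mat3_def mat_of_rows_list_def)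

lemma diag3_index: "i < 3 \<Longrightarrow> j < 3 \<Longrightarrow> diag3 R $$ (i, j) = (if i = j then R ! i else 0)"
  by (simp add: diag3_def mat_diag_def)

text \<open>Taking \<tau> to be the inverse of \<sigma> removes the inverse from
  \<open>perm_act\<close>, so that permuted entries can be read off directly.\<close>

lemma perm_closure_iff:
  "(B, R) \<in> perm_closure P \<longleftrightarrow>
     (\<exists>\<tau> B\<^sub>0 R\<^sub>0. \<tau> permutes {..<3} \<and> (B\<^sub>0, R\<^sub>0) \<in> P \<and>
        B = mat 3 3 (\<lambda>(i, j). B\<^sub>0 $$ (\<tau> i, \<tau> j)) \<and> R = mat 3 3 (\<lambda>(i, j). R\<^sub>0 $$ (\<tau> i, \<tau> j)))"
    (is "_ \<longleftrightarrow> ?rhs")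
proof
  assume "(B, R) \<in> perm_closure P"
  then obtain \<sigma> B\<^sub>0 R\<^sub>0 where "\<sigma> permutes {..<3}" "(B\<^sub>0, R\<^sub>0) \<in> P"
    "B = perm_act \<sigma> B\<^sub>0" "R = perm_act \<sigma> R\<^sub>0"
    by (auto simp: perm_closure_def)
  then show ?rhs
    using permutes_inv[of \<sigma> "{..<3}"] unfolding perm_act_def by blast
next
  assume ?rhs
  then obtain \<tau> B\<^sub>0 R\<^sub>0 where perm: "\<tau> permutes {..<3}" and P: "(B\<^sub>0, R\<^sub>0) \<in> P"
    and BR: "B = mat 3 3 (\<lambda>(i, j). B\<^sub>0 $$ (\<tau> i, \<tau> j))" "R = mat 3 3 (\<lambda>(i, j). R\<^sub>0 $$ (\<tau> i, \<tau> j))"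
    by blast
  have "B = perm_act (inv_into UNIV \<tau>) B\<^sub>0" "R = perm_act (inv_into UNIV \<tau>) R\<^sub>0"
    unfolding perm_act_def permutes_inv_inv[OF perm] by (fact BR)+
  then show "(B, R) \<in> perm_closure P"
    unfolding perm_closure_def using permutes_inv[OF perm] P by blast
qed

lemma perm_closure_Un: "perm_closure (P \<union> Q) = perm_closure P \<union> perm_closure Q"
  by (auto simp: perm_closure_def)

lemma perms3_permutes:
  assumes "p \<in> set perms3"
  shows "\<exists>\<tau>. \<tau> permutes {..<3} \<and> (\<forall>i<3. \<tau> i = p ! i)" "length p = 3"
proof -
  define \<tau> where "\<tau> i = (if i < 3 then p ! i else i)" for i
  have "{..<3} = {0, 1, 2 :: nat}" by auto
  moreover from assms have "bij_betw \<tau> {0, 1, 2} {0, 1, 2}"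
    by (auto simp: perms3_def bij_betw_def inj_on_def \<tau>_def)
  ultimately have "\<tau> permutes {..<3}"
    by (intro bij_imp_permutes) (auto simp: \<tau>_def)
  then show "\<exists>\<tau>. \<tau> permutes {..<3} \<and> (\<forall>i<3. \<tau> i = p ! i)"
    by (intro exI[of _ \<tau>]) (simp add: \<tau>_def)
  show "length p = 3" using assms by (auto simp: perms3_def)
qed

lemma pair_of_perm_rows:
  assumes p: "p \<in> set perms3" and x: "x \<in> set listed_rows"
  shows "pair_of_rows (perm_rows p x) \<in> perm_closure listed_pairs"
proof -
  obtain L R where LR: "x = (L, R)" by fastforce
  have L: "length L = 3" using x length_listed_rows by (simp add: LR)
  obtain \<tau> where \<tau>: "\<tau> permutes {..<3}" "\<And>i. i < 3 \<Longrightarrow> \<tau> i = p ! i"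
    using perms3_permutes(1)[OF p] by blast
  have p3: "length p = 3" by (rule perms3_permutes(2)[OF p])
  have lt: "p ! i < 3" if "i < 3" for i
    using permutes_in_image[OF \<tau>(1), of i] \<tau>(2) that by simp
  \<comment> \<open>Injectivity keeps the off-diagonal entries of the permuted diagonal matrix
    zero.\<close>
  have inj: "p ! i = p ! j \<longleftrightarrow> i = j" if "i < 3" "j < 3" for i j
    using permutes_inj[OF \<tau>(1)] \<tau>(2) that by (metis injD)
  have "mat3 (map (\<lambda>i. map (\<lambda>j. L ! i ! j) p) p) = mat 3 3 (\<lambda>(i, j). mat3 L $$ (\<tau> i, \<tau> j))"
    using L p3 \<tau>(2) lt by (intro eq_matI) (simp_all add: mat3_index, simp_all add: mat3_def mat_of_rows_list_def)
  moreover have "diag3 (map ((!) R) p) = mat 3 3 (\<lambda>(i, j). diag3 R $$ (\<tau> i, \<tau> j))"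
    using p3 \<tau>(2) lt inj by (intro eq_matI) (simp_all add: diag3_index, simp_all add: diag3_def mat_diag_def)
  moreover have "(mat3 L, diag3 R) \<in> listed_pairs"
    unfolding listed_pairs_rows using x by (force simp: LR pair_of_rows_def)
  ultimately show ?thesis
    using \<tau>(1) unfolding LR perm_rows_def pair_of_rows_def prod.case perm_closure_iff by blast
qed

definition all_rows :: "(int list list \<times> int list) list" where
  "all_rows = concat (map (\<lambda>p. map (perm_rows p) listed_rows) perms3)"

lemma pair_of_all_rows:
  "y \<in> set all_rows \<Longrightarrow> pair_of_rows y \<in> perm_closure listed_pairs"
  using pair_of_perm_rows by (auto simp: all_rows_def)

text \<open>
  Disjunctions are used instead of implications because \<open>code_simp\<close> evaluates the second disjunct
  only after the first one has been decided.
\<close>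

lemma all_rows_solutions:
  "\<forall>r0\<in>set [1, 2, 4]. \<forall>r1\<in>set [1, 2, 4]. \<forall>a01\<in>set [1, 2, 4]. \<forall>a10\<in>set [1, 2, 4]. r0 * r1 * a01 * a10 \<noteq> 4 \<or>
   (\<forall>r2\<in>set [1, 2, 4]. \<forall>a12\<in>set [1, 2, 4]. \<forall>a21\<in>set [1, 2, 4]. r1 * r2 * a12 * a21 \<noteq> 4 \<or>
   (\<forall>a02\<in>set [1, 2, 4]. 2 * a02 \<noteq> r1 * a01 * a12 \<or> 2 * a12 \<noteq> r0 * a10 * a02 \<or> 2 * a01 \<noteq> r2 * a02 * a21 \<or>
   (\<forall>a20\<in>set [1, 2, 4]. 2 * a20 \<noteq> r1 * a21 * a10 \<or> 2 * a10 \<noteq> r2 * a12 * a20 \<or> 2 * a21 \<noteq> r0 * a20 * a01 \<or>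
     ([[0, a01, - a02], [- a10, 0, a12], [a20, - a21, 0]], [r0, r1, r2]) \<in> set all_rows \<and>
     ([[0, - a01, a02], [a10, 0, - a12], [- a20, a21, 0]], [r0, r1, r2 :: int]) \<in> set all_rows)))"
  by code_simp

lemma listed_rows_mut_negates:
  "\<forall>(L, R)\<in>set listed_rows. \<forall>i\<in>set [0, 1, 2]. \<forall>j\<in>set [0, 1, 2]. \<forall>k\<in>set [0, 1, 2].
     i \<noteq> j \<longrightarrow> j \<noteq> k \<longrightarrow> i \<noteq> k \<longrightarrow>
     - 2 * L ! j ! i = R ! k * (pos_part (L ! j ! k) * L ! k ! i + L ! j ! k * pos_part (- L ! k ! i))"
  by code_simp

text \<open>The degree 4 in \<open>rows_II2\<close> is the only one above 2, so this is the only
  listed pair for which reciprocity is not automatic.\<close>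

lemma listed_rows_degrees:
  "\<forall>(L, R)\<in>set listed_rows. (L, R) = rows_II2 \<or> (\<forall>i\<in>set [0, 1, 2]. R ! i \<le> 2)"
  by code_simp

section \<open>Classification in rank 3\<close>

lemma dvd_4_cases:
  fixes x :: int
  assumes "x \<ge> 1" "x dvd 4"
  shows "x \<in> set [1, 2, 4]"
proof -
  have "x \<le> 4" using zdvd_imp_le[OF assms(2)] by simp
  then have "x = 1 \<or> x = 2 \<or> x = 3 \<or> x = 4" using assms(1) by linarith
  then show ?thesis using assms(2) by auto
qed

text \<open>Substituting one equation into another gives a product of two degrees and two entries
  equal to 4 for each edge. So all nine numbers divide 4, and the finite search applies. The two
  conclusions are the two cyclic orientations of the triangle.\<close>

lemma triangle_in_all_rows:
  fixes a01 a02 a10 a12 a20 a21 r0 r1 r2 :: int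
  assumes pos: "a01 \<ge> 1" "a02 \<ge> 1" "a10 \<ge> 1" "a12 \<ge> 1" "a20 \<ge> 1" "a21 \<ge> 1" "r0 \<ge> 1" "r1 \<ge> 1" "r2 \<ge> 1"
    and eqs: "2 * a01 = r2 * a02 * a21" "2 * a10 = r2 * a12 * a20" "2 * a02 = r1 * a01 * a12"
      "2 * a20 = r1 * a21 * a10" "2 * a12 = r0 * a10 * a02" "2 * a21 = r0 * a20 * a01"
  shows "([[0, a01, - a02], [- a10, 0, a12], [a20, - a21, 0]], [r0, r1, r2]) \<in> set all_rows"
    and "([[0, - a01, a02], [a10, 0, - a12], [- a20, a21, 0]], [r0, r1, r2]) \<in> set all_rows"
proof -
  have prod4: "r * s * a * b = 4" if "2 * c = s * d * b" "2 * d = r * c * a" "c \<ge> 1" for r s a b c d :: int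
  proof -
    have "c * 4 = s * (2 * d) * b" using that(1) by simp
    also have "\<dots> = c * (r * s * a * b)" using that(2) by simp
    finally show ?thesis using that(3) by simp
  qed
  have p01: "r0 * r1 * a01 * a10 = 4"
    using eqs pos by (intro prod4[of a20 r1 a21 a10 r0 a01]) auto
  have p12: "r1 * r2 * a12 * a21 = 4"
    using eqs pos by (intro prod4[of a01 r2 a02 a21 r1 a12]) auto
  have p02: "r2 * r0 * a20 * a02 = 4"
    using eqs pos by (intro prod4[of a12 r0 a10 a02 r2 a20]) auto
  note dom = dvd_4_cases[OF pos(1)] dvd_4_cases[OF pos(2)] dvd_4_cases[OF pos(3)]
    dvd_4_cases[OF pos(4)] dvd_4_cases[OF pos(5)] dvd_4_cases[OF pos(6)]
    dvd_4_cases[OF pos(7)] dvd_4_cases[OF pos(8)] dvd_4_cases[OF pos(9)]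
  have "a01 dvd 4" "a10 dvd 4" "r0 dvd 4" "r1 dvd 4"
    unfolding p01[symmetric] by simp_all
  moreover have "a12 dvd 4" "a21 dvd 4" "r2 dvd 4"
    unfolding p12[symmetric] by simp_all
  moreover have "a02 dvd 4" "a20 dvd 4"
    unfolding p02[symmetric] by simp_all
  ultimately have dvds: "a01 dvd 4" "a02 dvd 4" "a10 dvd 4" "a12 dvd 4" "a20 dvd 4" "a21 dvd 4"
    "r0 dvd 4" "r1 dvd 4" "r2 dvd 4"
    by simp_all
  have disj: "P" if "x \<noteq> y \<or> P" "x = y" for x y :: int and P
    using that by blast
  \<comment> \<open>The instantiation follows the order in which \<open>all_rows_solutions\<close>
    interleaves quantifiers and tests; each \<open>disj\<close> discards a disjunct refuted by a
    known equation.\<close>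
  note s = bspec[OF bspec[OF bspec[OF bspec[OF all_rows_solutions dom(7)[OF dvds(7)]]
    dom(8)[OF dvds(8)]] dom(1)[OF dvds(1)]] dom(3)[OF dvds(3)]]
  note s = bspec[OF bspec[OF bspec[OF disj[OF s p01] dom(9)[OF dvds(9)]] dom(4)[OF dvds(4)]]
    dom(6)[OF dvds(6)]]
  note s = disj[OF disj[OF disj[OF bspec[OF disj[OF s p12] dom(2)[OF dvds(2)]] eqs(3)] eqs(5)] eqs(1)]
  note s = disj[OF disj[OF disj[OF bspec[OF s dom(5)[OF dvds(5)]] eqs(4)] eqs(2)] eqs(6)]
  show "([[0, a01, - a02], [- a10, 0, a12], [a20, - a21, 0]], [r0, r1, r2]) \<in> set all_rows"
    and "([[0, - a01, a02], [a10, 0, - a12], [- a20, a21, 0]], [r0, r1, r2]) \<in> set all_rows"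
    using s by blast+
qed

text \<open>Signs and absolute values separate: by cyclicity the sign of \<open>b 0 1\<close>
  determines all other signs, while the absolute values satisfy the triangle equations.\<close>

lemma mut_negates_3_imp_listed:
  assumes B: "B \<in> carrier_mat 3 3" and skew: "skew_symmetrizable 3 B"
    and nz: "\<And>i j. i < 3 \<Longrightarrow> j < 3 \<Longrightarrow> i \<noteq> j \<Longrightarrow> B $$ (i, j) \<noteq> 0"
    and r: "\<And>i. i < 3 \<Longrightarrow> r i \<ge> 1"
    and neg: "mut_negates 3 r (\<lambda>i j. B $$ (i, j))"
  shows "(B, mat_diag 3 r) \<in> perm_closure listed_pairs"
proof -
  define b where "b i j = B $$ (i, j)" for i j
  have neg': "mut_negates 3 r b" using neg by (simp add: b_def[abs_def])
  have nz': "b i j \<noteq> 0" if "i < 3" "j < 3" "i \<noteq> j" for i j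
    using nz that by (simp add: b_def)
  have sgn: "b i j > 0 \<longleftrightarrow> b j i < 0" if "i < 3" "j < 3" for i j
    unfolding b_def by (rule skew_symmetrizable_entries(1)[OF skew B that])
  have diag: "b i i = 0" if "i < 3" for i
    unfolding b_def by (rule skew_symmetrizable_entries(2)[OF skew B that that])
  have cyc: "b j k > 0 \<longleftrightarrow> b k i > 0"
    if "i < 3" "j < 3" "k < 3" "i \<noteq> j" "j \<noteq> k" "i \<noteq> k" for i j k
    by (rule mut_negates_path(2)[OF neg' sgn that nz' nz']) (use that in auto)
  have abs: "2 * \<bar>b j i\<bar> = r k * \<bar>b j k\<bar> * \<bar>b k i\<bar>"
    if ijk: "i < 3" "j < 3" "k < 3" "i \<noteq> j" "j \<noteq> k" "i \<noteq> k" for i j k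
  proof -
    have n: "b k i \<noteq> 0" "b j k \<noteq> 0" using nz' ijk by auto
    have "- 2 * b j i = r k * (pos_part (b j k) * b k i + b j k * pos_part (- b k i))"
      using neg' ijk n unfolding mut_negates_def by blast
    \<comment> \<open>Both entries have the same sign, so exactly one summand survives, and it has
      this form in either case.\<close>
    also have "pos_part (b j k) * b k i + b j k * pos_part (- b k i) = \<bar>b j k\<bar> * b k i"
      using cyc[OF ijk] n by (cases "b j k > 0") (simp_all add: pos_part_def max_def)
    finally have "\<bar>- 2 * b j i\<bar> = \<bar>r k * (\<bar>b j k\<bar> * b k i)\<bar>" by simp
    then show ?thesis using r[OF ijk(3)] by (simp add: abs_mult)
  qed
  have pos: "\<bar>b i j\<bar> \<ge> 1" if "i < 3" "j < 3" "i \<noteq> j" for i j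
    using nz'[OF that] by linarith
  have tri: "([[0, \<bar>b 0 1\<bar>, - \<bar>b 0 2\<bar>], [- \<bar>b 1 0\<bar>, 0, \<bar>b 1 2\<bar>], [\<bar>b 2 0\<bar>, - \<bar>b 2 1\<bar>, 0]], [r 0, r 1, r 2]) \<in> set all_rows"
    "([[0, - \<bar>b 0 1\<bar>, \<bar>b 0 2\<bar>], [\<bar>b 1 0\<bar>, 0, - \<bar>b 1 2\<bar>], [- \<bar>b 2 0\<bar>, \<bar>b 2 1\<bar>, 0]], [r 0, r 1, r 2]) \<in> set all_rows"
    by (intro triangle_in_all_rows pos abs r; simp)+
  have "([[0, b 0 1, b 0 2], [b 1 0, 0, b 1 2], [b 2 0, b 2 1, 0]], [r 0, r 1, r 2]) \<in> set all_rows"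
  proof (cases "b 0 1 > 0")
    case True
    then have "b 1 2 > 0" "b 2 0 > 0"
      using cyc[of 2 0 1] cyc[of 0 1 2] by auto
    moreover have "b 1 0 < 0" "b 2 1 < 0" "b 0 2 < 0"
      using True calculation sgn by auto
    ultimately show ?thesis using True tri(1) by (simp add: abs_if)
  next
    case False
    then have "\<not> b 1 2 > 0" "\<not> b 2 0 > 0"
      using cyc[of 2 0 1] cyc[of 0 1 2] by auto
    then have "b 0 1 < 0" "b 1 2 < 0" "b 2 0 < 0"
      using False nz'[of 0 1] nz'[of 1 2] nz'[of 2 0] by auto
    moreover have "b 1 0 > 0" "b 2 1 > 0" "b 0 2 > 0"
      using calculation sgn by auto
    ultimately show ?thesis using tri(2) by (simp add: abs_if)
  qed
  from pair_of_all_rows[OF this]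
  have "(mat3 [[0, b 0 1, b 0 2], [b 1 0, 0, b 1 2], [b 2 0, b 2 1, 0]], diag3 [r 0, r 1, r 2])
      \<in> perm_closure listed_pairs"
    by (simp add: pair_of_rows_def)
  moreover have lt3: "i = 0 \<or> i = 1 \<or> i = 2" if "i < 3" for i :: nat
    using that by linarith
  have "mat3 [[0, b 0 1, b 0 2], [b 1 0, 0, b 1 2], [b 2 0, b 2 1, 0]] = B"
  proof (rule eq_matI)
    fix i j assume "i < dim_row B" "j < dim_col B"
    then have ij: "i < 3" "j < 3" using B by auto
    show "mat3 [[0, b 0 1, b 0 2], [b 1 0, 0, b 1 2], [b 2 0, b 2 1, 0]] $$ (i, j) = B $$ (i, j)"
      using lt3[OF ij(1)] lt3[OF ij(2)] diag[of 0] diag[of 1] diag[of 2]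
      by (auto simp: mat3_index b_def)
  qed (use B in \<open>simp_all add: mat3_def mat_of_rows_list_def\<close>)
  moreover have "diag3 [r 0, r 1, r 2] = mat_diag 3 r"
    using lt3 by (intro eq_matI) (force simp: diag3_def mat_diag_def)+
  ultimately show ?thesis by simp
qed

text \<open>The parameter \<open>P\<close> lets this serve both the full list and the list without
  \<open>rows_II2\<close>.\<close>

lemma listed_imp_rows:
  assumes "(B, mat_diag 3 r) \<in> perm_closure (pair_of_rows ` P)" "P \<subseteq> set listed_rows"
  obtains \<tau> L R where "\<tau> permutes {..<3}" "(L, R) \<in> P"
    "\<And>i j. i < 3 \<Longrightarrow> j < 3 \<Longrightarrow> B $$ (i, j) = L ! \<tau> i ! \<tau> j"
    "\<And>i. i < 3 \<Longrightarrow> r i = R ! \<tau> i"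
proof -
  obtain \<tau> B\<^sub>0 R\<^sub>0 where t: "\<tau> permutes {..<3}" "(B\<^sub>0, R\<^sub>0) \<in> pair_of_rows ` P"
    "B = mat 3 3 (\<lambda>(i, j). B\<^sub>0 $$ (\<tau> i, \<tau> j))" "mat_diag 3 r = mat 3 3 (\<lambda>(i, j). R\<^sub>0 $$ (\<tau> i, \<tau> j))"
    using assms(1) unfolding perm_closure_iff by blast
  then obtain L R where LR: "(L, R) \<in> P" "B\<^sub>0 = mat3 L" "R\<^sub>0 = diag3 R"
    by (auto simp: pair_of_rows_def)
  have L: "length L = 3" using LR(1) assms(2) length_listed_rows by blast
  have lt: "\<tau> i < 3" if "i < 3" for i
    using permutes_in_image[OF t(1), of i] that by simp
  have "B $$ (i, j) = L ! \<tau> i ! \<tau> j" if "i < 3" "j < 3" for i j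
    using that lt L by (simp add: t(3) LR(2) mat3_index)
  moreover have "r i = R ! \<tau> i" if "i < 3" for i
    using arg_cong[OF t(4), of "\<lambda>M. M $$ (i, i)"] that lt by (simp add: LR(3) diag3_index mat_diag_def)
  ultimately show thesis using that t(1) LR(1) by blast
qed

text \<open>The equations are unaffected by simultaneous relabelling, so their verification on the
  unpermuted rows suffices.\<close>

lemma listed_imp_mut_negates_3:
  assumes "(B, mat_diag 3 r) \<in> perm_closure listed_pairs"
  shows "mut_negates 3 r (\<lambda>i j. B $$ (i, j))"
  unfolding mut_negates_def
proof (intro allI impI)
  obtain \<tau> L R where t: "\<tau> permutes {..<3}" and LR: "(L, R) \<in> set listed_rows"
    and B: "\<And>i j. i < 3 \<Longrightarrow> j < 3 \<Longrightarrow> B $$ (i, j) = L ! \<tau> i ! \<tau> j"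
    and r: "\<And>i. i < 3 \<Longrightarrow> r i = R ! \<tau> i"
    using listed_imp_rows[OF assms[unfolded listed_pairs_rows]] by blast
  fix i j k :: nat assume ijk: "i < 3" "j < 3" "k < 3" "i \<noteq> j" "j \<noteq> k" "i \<noteq> k"
  have mem: "\<tau> l \<in> set [0, 1, 2]" if "l < 3" for l
    using permutes_in_image[OF t, of l] that by auto
  have "\<tau> i \<noteq> \<tau> j" "\<tau> j \<noteq> \<tau> k" "\<tau> i \<noteq> \<tau> k"
    using permutes_inj[OF t] ijk by (auto dest: injD)
  then have "- 2 * L ! \<tau> j ! \<tau> i = R ! \<tau> k *
      (pos_part (L ! \<tau> j ! \<tau> k) * L ! \<tau> k ! \<tau> i + L ! \<tau> j ! \<tau> k * pos_part (- L ! \<tau> k ! \<tau> i))"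
    using listed_rows_mut_negates LR mem[OF ijk(1)] mem[OF ijk(2)] mem[OF ijk(3)] by blast
  then show "- 2 * B $$ (j, i) = r k *
      (pos_part (B $$ (j, k)) * B $$ (k, i) + B $$ (j, k) * pos_part (- B $$ (k, i)))"
    using B r ijk by simp
qed

text \<open>The two end coefficients are 1, and in degree 2 the middle index is its own mirror
  image.\<close>

lemma reciprocal_if_degree_le_2:
  assumes "\<And>i. i < n \<Longrightarrow> Polynomial.degree (Z $ i) \<le> 2"
    and "\<And>i. i < n \<Longrightarrow> coeff (Z $ i) 0 = 1 \<and> lead_coeff (Z $ i) = 1"
  shows "reciprocal n Z"
  unfolding reciprocal_def
proof (intro allI impI)
  fix i s assume i: "i < n" and s: "s \<le> Polynomial.degree (Z $ i)"
  then have "s = 0 \<or> s = Polynomial.degree (Z $ i) \<or> s = Polynomial.degree (Z $ i) - s"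
    using assms(1)[OF i] by linarith
  then show "coeff (Z $ i) s = coeff (Z $ i) (Polynomial.degree (Z $ i) - s)"
    using assms(2)[OF i] by force
qed

lemma listed_not_II2_degrees:
  assumes "(B, mat_diag 3 r) \<in> perm_closure (listed_pairs - {pair_II2})" "i < 3"
  shows "r i \<le> 2"
proof -
  \<comment> \<open>This inclusion holds for the image under any map, so no injectivity of
    \<open>pair_of_rows\<close> enters.\<close>
  have "listed_pairs - {pair_II2} \<subseteq> pair_of_rows ` (set listed_rows - {rows_II2})"
    unfolding listed_pairs_rows pair_II2_rows by blast
  then have "(B, mat_diag 3 r) \<in> perm_closure (pair_of_rows ` (set listed_rows - {rows_II2}))"
    using assms(1) unfolding perm_closure_def by blast
  then obtain \<tau> L R where t: "\<tau> permutes {..<3}" and LR: "(L, R) \<in> set listed_rows" "(L, R) \<noteq> rows_II2"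
    and r: "\<And>i. i < 3 \<Longrightarrow> r i = R ! \<tau> i"
    by (rule listed_imp_rows) auto
  have "\<tau> i \<in> set [0, 1, 2]"
    using permutes_in_image[OF t, of i] assms(2) by auto
  then show ?thesis
    using listed_rows_degrees LR r[OF assms(2)] by fastforce
qed

section \<open>The classification in all ranks\<close>

theorem theorem1p2:
  fixes n :: nat and \<Sigma> :: "nat list \<Rightarrow> gseed" and t\<^sub>0 :: "nat list"
    and x :: "ratfun vec" and B :: "int mat" and Z :: "nat poly vec"
  assumes "n \<ge> 2"
    and "gen_cluster_pattern n \<Sigma>"
    and "t\<^sub>0 \<in> tree_vertices n"
    and "\<Sigma> t\<^sub>0 = (x, B, Z)"
  shows "(irreducible_mat n B \<and> mutation_preserving n \<Sigma> t\<^sub>0) \<longleftrightarrow>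
         (irreducible_mat n B \<and>
           ((n = 2 \<and> reciprocal n Z) \<or>
            (n = 3 \<and> (B, degree_mat n Z) \<in> perm_closure (listed_pairs - {pair_II2})) \<or>
            (n = 3 \<and> (B, degree_mat n Z) \<in> perm_closure {pair_II2} \<and> reciprocal n Z)))"
proof (cases "irreducible_mat n B")
  case irr: True
  define r where "r i = int (Polynomial.degree (Z $ i))" for i
  define neg where "neg \<longleftrightarrow> mut_negates n r (\<lambda>i j. B $$ (i, j))"
  have seed: "is_gseed n (x, B, Z)"
    using assms(2-4) unfolding gen_cluster_pattern_def by metis
  then have B: "B \<in> carrier_mat n n" and skew: "skew_symmetrizable n B"
    by (simp_all add: is_gseed_def)
  have monic: "Polynomial.degree (Z $ i) \<ge> 1 \<and> coeff (Z $ i) 0 = 1 \<and> lead_coeff (Z $ i) = 1"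
    if "i < n" for i
    using seed that by (auto simp: is_gseed_def)
  have D: "degree_mat n Z = mat_diag n r"
    by (simp add: degree_mat_def r_def[abs_def])
  have complete: "B $$ (i, j) \<noteq> 0" if neg "i < n" "j < n" "i \<noteq> j" for i j
    using irr B skew_symmetrizable_entries(1)[OF skew B] that unfolding neg_def
    by (rule irreducible_mut_negates_complete)
  have rank: "n = 2 \<or> n = 3" if neg
  proof -
    have "n \<le> 3"
      using skew_symmetrizable_entries(1)[OF skew B] that[unfolded neg_def] complete[OF that]
      by (rule mut_negates_complete_rank)
    then show ?thesis using assms(1) by linarith
  qed
  \<comment> \<open>With only two indices there is no triple to constrain, so in rank 2 reciprocity
    is the whole condition.\<close>
  have neg2: neg if "n = 2"
    using that by (auto simp: neg_def mut_negates_def less_2_cases_iff)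
  have neg3: "neg \<longleftrightarrow> (B, degree_mat n Z) \<in> perm_closure listed_pairs" if n: "n = 3"
  proof
    assume neg
    then show "(B, degree_mat n Z) \<in> perm_closure listed_pairs"
      using mut_negates_3_imp_listed[of B r] B skew complete monic n
      unfolding D neg_def by (simp add: r_def)
  next
    assume "(B, degree_mat n Z) \<in> perm_closure listed_pairs"
    then show neg
      using listed_imp_mut_negates_3 n unfolding D neg_def by blast
  qed
  \<comment> \<open>The split separates the pairs whose degrees force reciprocity from the one for
    which it must be required.\<close>
  have "listed_pairs = (listed_pairs - {pair_II2}) \<union> {pair_II2}"
    by (auto simp: listed_pairs_def)
  then have split: "perm_closure listed_pairs =
      perm_closure (listed_pairs - {pair_II2}) \<union> perm_closure {pair_II2}"
    by (metis perm_closure_Un)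
  have rec: "reciprocal n Z" if "n = 3" "(B, degree_mat n Z) \<in> perm_closure (listed_pairs - {pair_II2})"
  proof (rule reciprocal_if_degree_le_2)
    have "(B, mat_diag 3 r) \<in> perm_closure (listed_pairs - {pair_II2})"
      using that unfolding D by simp
    then show "Polynomial.degree (Z $ i) \<le> 2" if "i < n" for i
      using listed_not_II2_degrees[of B r i] that \<open>n = 3\<close> by (simp add: r_def)
  qed (use monic in blast)
  have "mutation_preserving n \<Sigma> t\<^sub>0 \<longleftrightarrow> neg \<and> reciprocal n Z"
    using mutation_preserving_iff[OF assms irr] by (simp add: neg_def r_def[abs_def])
  then show ?thesis
    using irr rank neg2 neg3 split rec by blast
qed simp

end
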